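(* Let $\delta\geq 2$ be an integer and let $G$ be a connected graph of even order $n\geq\max\{6\delta-4,\frac{1}{6}(\delta^{2}+7\delta+4)\}$ with minimum degree $\delta(G)=\delta$. If $$e(G)\geq e\big(K_{\delta}\vee(K_{n-2\delta+1}\cup(\delta-1)K_1)\big),$$ then $G$ contains an even factor, unless $G=K_{\delta}\vee(K_{n-2\delta+1}\cup(\delta-1)K_1)$.
   Context: All graphs are finite, undirected, without loops or multiple edges. $e(G)$ denotes the number of edges of $G$. $K_m$ is the complete graph on $m$ vertices; $(\delta-1)K_1$ is the graph consisting of $\delta-1$ isolated vertices. $G_1\cup G_2$ is the disjoint union of vertex-disjoint graphs, and the join $G_1\vee G_2$ is obtained from $G_1\cup G_2$ by adding all edges between $V(G_1)$ and $V(G_2)$. An even factor of $G$ is a spanning subgraph $F$ of $G$ such that $d_F(v)\in\{2,4,6,\ldots\}$ for every vertex $v\in V(G)$. *)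

theory Defs
  imports Complex_Main
begin

record 'a graph =
  verts :: "'a set"
  edges :: "'a set set"

definition simple_graph :: "'a graph \<Rightarrow> bool" where
  "simple_graph G \<longleftrightarrow> finite (verts G) \<and> edges G \<subseteq> {e. e \<subseteq> verts G \<and> card e = 2}"

definition graph_order :: "'a graph \<Rightarrow> nat" where
  "graph_order G = card (verts G)"

definition num_edges :: "'a graph \<Rightarrow> nat" where
  "num_edges G = card (edges G)"

definition degree :: "'a graph \<Rightarrow> 'a \<Rightarrow> nat" where
  "degree G v = card {e \<in> edges G. v \<in> e}"

definition min_degree :: "'a graph \<Rightarrow> nat" where
  "min_degree G = Min (degree G ` verts G)"

definition connected_graph :: "'a graph \<Rightarrow> bool" where
  "connected_graph G \<longleftrightarrow>
     verts G \<noteq> {} \<and> (\<forall>u\<in>verts G. \<forall>v\<in>verts G. (u, v) \<in> {(x, y). {x, y} \<in> edges G}\<^sup>*)"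

definition complete_graph :: "nat \<Rightarrow> nat graph" where
  "complete_graph m = \<lparr>verts = {..<m}, edges = {e. e \<subseteq> {..<m} \<and> card e = 2}\<rparr>"

definition isolated_vertices :: "nat \<Rightarrow> nat graph" where
  "isolated_vertices m = \<lparr>verts = {..<m}, edges = {}\<rparr>"

text \<open>The sum type makes the two vertex sets disjoint.\<close>

definition disjoint_union :: "'a graph \<Rightarrow> 'b graph \<Rightarrow> ('a + 'b) graph" where
  "disjoint_union G H =
     \<lparr>verts = verts G <+> verts H,
      edges = (\<lambda>e. Inl ` e) ` edges G \<union> (\<lambda>e. Inr ` e) ` edges H\<rparr>"

definition join :: "'a graph \<Rightarrow> 'b graph \<Rightarrow> ('a + 'b) graph" where
  "join G H =
     \<lparr>verts = verts (disjoint_union G H),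
      edges = edges (disjoint_union G H) \<union> {{Inl u, Inr v} | u v. u \<in> verts G \<and> v \<in> verts H}\<rparr>"

definition isomorphic :: "'a graph \<Rightarrow> 'b graph \<Rightarrow> bool" where
  "isomorphic G H \<longleftrightarrow>
     (\<exists>f. bij_betw f (verts G) (verts H) \<and>
          (\<forall>u\<in>verts G. \<forall>v\<in>verts G. {u, v} \<in> edges G \<longleftrightarrow> {f u, f v} \<in> edges H))"

definition spanning_subgraph :: "'a graph \<Rightarrow> 'a graph \<Rightarrow> bool" where
  "spanning_subgraph F G \<longleftrightarrow> verts F = verts G \<and> edges F \<subseteq> edges G"

definition even_factor :: "'a graph \<Rightarrow> 'a graph \<Rightarrow> bool" where
  "even_factor F G \<longleftrightarrow>
     spanning_subgraph F G \<and> (\<forall>v\<in>verts G. even (degree F v) \<and> degree F v \<ge> 2)"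

text \<open>
  The subtractions are on natural numbers; they are exact for \<open>\<delta> \<ge> 1\<close> and \<open>n \<ge> 2 * \<delta>\<close>.
\<close>

definition extremal_graph :: "nat \<Rightarrow> nat \<Rightarrow> (nat + nat + nat) graph" where
  "extremal_graph n \<delta> =
     join (complete_graph \<delta>)
          (disjoint_union (complete_graph (n - 2 * \<delta> + 1)) (isolated_vertices (\<delta> - 1)))"

end

theory Submission
  imports Defs
begin

text \<open>
  The graph \<open>G\<close> is Hamiltonian, and a Hamiltonian cycle is an even factor. Suppose not, and add
  edges to reach an edge-maximal non-Hamiltonian graph \<open>H\<close>. By Ore's crossing argument nonadjacent
  vertices of \<open>H\<close> have degree sum less than \<open>n\<close>. Take nonadjacent \<open>u\<close> and \<open>v\<close> with maximal degree
  sum and \<open>i = d(u) \<le> d(v)\<close>. Then \<open>\<delta> \<le> i < n/2\<close>, and the at least \<open>n - 1 - d(v) \<ge> i\<close>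
  nonneighbours of \<open>v\<close> have degree at most \<open>i\<close>. So \<open>G\<close> has at most \<open>i\<^sup>2 + (n - i choose 2)\<close> edges
  (Erdos). For \<open>\<delta> \<le> i < n/2\<close> with \<open>n\<close> even this is less than the number of edges of the extremal
  graph: twice the difference is \<open>(i - \<delta>) (2 n - 1 - 3 i - 3 \<delta>) + 2 (n - 2 \<delta>)\<close>, and \<open>n \<ge> 6 \<delta> - 4\<close>
  makes both factors of the product nonnegative.
\<close>

section \<open>Degrees and edge counts\<close>

lemma simple_graph_finite_edges: "simple_graph G \<Longrightarrow> finite (edges G)"
  unfolding simple_graph_def by (rule finite_subset[of _ "Pow (verts G)"]) auto

lemma simple_graph_edgeD:
  assumes "simple_graph G" "{x, y} \<in> edges G"
  shows "x \<noteq> y" "x \<in> verts G" "y \<in> verts G"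
proof -
  have "{x, y} \<subseteq> verts G" "card {x, y} = 2"
    using assms by (auto simp: simple_graph_def)
  then show "x \<noteq> y" "x \<in> verts G" "y \<in> verts G" by auto
qed

text \<open>Degrees are defined through incident edges, whereas Ore's argument locates neighbours on
  a path; \<open>w\<close> corresponds to the edge \<open>{v, w}\<close>.\<close>

lemma degree_eq_card_neighbours:
  assumes "simple_graph G"
  shows "degree G v = card {w. {v, w} \<in> edges G}"
proof -
  have "{e \<in> edges G. v \<in> e} = (\<lambda>w. {v, w}) ` {w. {v, w} \<in> edges G}" (is "?L = ?R")
  proof
    show "?L \<subseteq> ?R"
    proof
      fix e assume e: "e \<in> ?L"
      then have "card e = 2" using assms by (auto simp: simple_graph_def)
      then obtain a b where "e = {a, b}" by (auto simp: card_2_iff)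
      with e show "e \<in> ?R" by (auto simp: insert_commute)
    qed
  qed auto
  moreover have "inj_on (\<lambda>w. {v, w}) {w. {v, w} \<in> edges G}"
    by (auto simp: inj_on_def doubleton_eq_iff)
  ultimately show ?thesis by (simp add: degree_def card_image)
qed

lemma degree_mono:
  assumes "finite (edges H)" "edges G \<subseteq> edges H"
  shows "degree G v \<le> degree H v"
  unfolding degree_def using assms by (intro card_mono) auto

text \<open>An edge that meets \<open>S\<close> is counted by the degree of a vertex of
  \<open>S\<close>; all other edges are pairs in the complement of \<open>S\<close>.\<close>

lemma num_edges_le_small_degrees:
  assumes "simple_graph G" "S \<subseteq> verts G" and deg: "\<And>x. x \<in> S \<Longrightarrow> degree G x \<le> d"
  shows "num_edges G \<le> card S * d + (card (verts G) - card S choose 2)"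
proof -
  have fin: "finite (verts G)" "finite S"
    using assms finite_subset by (auto simp: simple_graph_def)
  let ?I = "\<Union>x\<in>S. {e \<in> edges G. x \<in> e}" and ?R = "{e. e \<subseteq> verts G - S \<and> card e = 2}"
  have "edges G \<subseteq> ?I \<union> ?R"
    using assms(1) by (auto simp: simple_graph_def)
  moreover have "finite ?I" "finite ?R"
    using fin simple_graph_finite_edges[OF assms(1)] by auto
  ultimately have "num_edges G \<le> card ?I + card ?R"
    unfolding num_edges_def by (meson card_Un_le card_mono finite_UnI le_trans)
  moreover have "card ?I \<le> (\<Sum>x\<in>S. degree G x)"
    unfolding degree_def by (rule card_UN_le[OF fin(2)])
  moreover have "\<dots> \<le> card S * d"
    using sum_bounded_above[of S "degree G" d] deg by simp
  moreover have "card ?R = (card (verts G) - card S) choose 2"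
    using fin assms(2) by (simp add: n_subsets card_Diff_subset)
  ultimately show ?thesis by linarith
qed

subsection \<open>Hamiltonian cycles\<close>

text \<open>The modulus closes the list up. With only two entries the list would traverse a single
  edge back and forth, hence the lower bound on the length.\<close>

definition hamiltonian_cycle :: "'a graph \<Rightarrow> 'a list \<Rightarrow> bool" where
  "hamiltonian_cycle G xs \<longleftrightarrow>
     distinct xs \<and> set xs = verts G \<and> 3 \<le> length xs \<and>
     (\<forall>i<length xs. {xs ! i, xs ! (Suc i mod length xs)} \<in> edges G)"

definition hamiltonian :: "'a graph \<Rightarrow> bool" where
  "hamiltonian G \<longleftrightarrow> (\<exists>xs. hamiltonian_cycle G xs)"

text \<open>Serves to move a chosen edge of the cycle to the place where the list wraps
  around.\<close>

lemma hamiltonian_cycle_rotate: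
  assumes "hamiltonian_cycle G xs"
  shows "hamiltonian_cycle G (rotate k xs)"
proof -
  let ?n = "length xs"
  have n: "0 < ?n" using assms by (auto simp: hamiltonian_cycle_def)
  have "{rotate k xs ! i, rotate k xs ! (Suc i mod ?n)} \<in> edges G" if "i < ?n" for i
  proof -
    have "(k + Suc i mod ?n) mod ?n = Suc ((k + i) mod ?n) mod ?n"
      by (metis add_Suc_right mod_Suc_eq mod_add_right_eq)
    moreover have "(k + i) mod ?n < ?n" using n by simp
    ultimately show ?thesis
      using assms that n by (simp add: hamiltonian_cycle_def nth_rotate)
  qed
  then show ?thesis using assms by (simp add: hamiltonian_cycle_def)
qed

text \<open>Any ordering of the vertices is a cycle. Used contrapositively: a non-Hamiltonian graph
  on at least three vertices has a nonadjacent pair.\<close>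

lemma hamiltonian_complete:
  assumes "finite (verts G)" "3 \<le> card (verts G)"
    and "\<And>x y. x \<in> verts G \<Longrightarrow> y \<in> verts G \<Longrightarrow> x \<noteq> y \<Longrightarrow> {x, y} \<in> edges G"
  shows "hamiltonian G"
proof -
  obtain xs where xs: "set xs = verts G" "distinct xs"
    using assms(1) finite_distinct_list by blast
  then have len: "3 \<le> length xs" using assms(2) distinct_card by metis
  have "{xs ! i, xs ! (Suc i mod length xs)} \<in> edges G" if i: "i < length xs" for i
  proof -
    have "Suc i mod length xs \<noteq> i" "Suc i mod length xs < length xs"
      using i len by (auto simp: mod_Suc)
    then show ?thesis
      using assms(3) i xs by (metis nth_eq_iff_index_eq nth_mem)
  qed
  then show ?thesis using xs len by (auto simp: hamiltonian_def hamiltonian_cycle_def)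
qed

lemma even_factor_of_hamiltonian:
  assumes "hamiltonian G"
  shows "\<exists>F. even_factor F G"
proof -
  obtain xs where xs: "distinct xs" "set xs = verts G" "3 \<le> length xs"
    and E: "\<And>i. i < length xs \<Longrightarrow> {xs ! i, xs ! (Suc i mod length xs)} \<in> edges G"
    using assms by (auto simp: hamiltonian_def hamiltonian_cycle_def)
  let ?n = "length xs"
  let ?e = "\<lambda>i. {xs ! i, xs ! (Suc i mod ?n)}"
  let ?F = "\<lparr>verts = verts G, edges = ?e ` {..<?n}\<rparr>"
  have "degree ?F v = 2" if v: "v \<in> verts G" for v
  proof -
    obtain k where k: "k < ?n" "v = xs ! k"
      using v xs(2) by (metis in_set_conv_nth)
    \<comment> \<open>\<open>p\<close> is the cyclic predecessor of \<open>k\<close>, so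
      \<open>?e p\<close> and \<open>?e k\<close> are the two cycle edges at \<open>v\<close>. They
      differ because \<open>p \<noteq> Suc k mod ?n\<close>, which holds as the length is at least
      3.\<close>
    define p where "p = (if k = 0 then ?n - 1 else k - 1)"
    have p: "p < ?n" "Suc p mod ?n = k" "p \<noteq> k" "p \<noteq> Suc k mod ?n"
      using k xs(3) by (auto simp: p_def mod_Suc)
    have sk: "Suc k mod ?n < ?n" using k(1) by (intro mod_less_divisor) linarith
    have "{e \<in> edges ?F. v \<in> e} = {?e k, ?e p}"
    proof
      show "{e \<in> edges ?F. v \<in> e} \<subseteq> {?e k, ?e p}"
      proof
        fix e assume "e \<in> {e \<in> edges ?F. v \<in> e}"
        then obtain i where i: "i < ?n" "e = ?e i" "v \<in> ?e i" by auto
        have "Suc i mod ?n < ?n" using i(1) by (intro mod_less_divisor) linarith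
        then have "k = i \<or> k = Suc i mod ?n"
          using i k xs(1) by (auto simp: nth_eq_iff_index_eq)
        then have "i = k \<or> i = p"
          using i k xs(3) by (auto simp: p_def mod_Suc split: if_splits)
        then show "e \<in> {?e k, ?e p}" using i by auto
      qed
      show "{?e k, ?e p} \<subseteq> {e \<in> edges ?F. v \<in> e}"
        using k p by auto
    qed
    moreover have "?e k \<noteq> ?e p"
      using k p sk xs(1) by (auto simp: doubleton_eq_iff nth_eq_iff_index_eq)
    ultimately show ?thesis by (simp add: degree_def)
  qed
  then have "even_factor ?F G"
    using E by (auto simp: even_factor_def spanning_subgraph_def)
  then show ?thesis ..
qed

section \<open>Ore's degree condition\<close>

text \<open>The cycle runs along the path from position 0 to \<open>i\<close>, jumps to the last
  vertex, runs backwards to position \<open>Suc i\<close> and returns to the start.\<close>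

lemma hamiltonian_path_crossing:
  assumes xs: "distinct xs" "set xs = verts G" "3 \<le> length xs"
    and path: "\<And>j. Suc j < length xs \<Longrightarrow> {xs ! j, xs ! Suc j} \<in> edges G"
    and i: "Suc i < length xs"
    and cross: "{xs ! 0, xs ! Suc i} \<in> edges G" "{xs ! i, xs ! (length xs - 1)} \<in> edges G"
  shows "hamiltonian G"
proof -
  let ?n = "length xs"
  define ys where "ys = take (Suc i) xs @ rev (drop (Suc i) xs)"
  have len: "length ys = ?n" using i by (simp add: ys_def)
  have set: "set ys = set xs"
    unfolding ys_def set_append set_rev by (metis append_take_drop_id set_append)
  have dist: "distinct ys"
    using xs(1) len set by (metis card_distinct distinct_card)
  have low: "ys ! j = xs ! j" if "j \<le> i" for j
    using that i by (simp add: ys_def nth_append)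
  \<comment> \<open>In the reversed part positions \<open>j\<close> and \<open>?n + i - j\<close>
    correspond: \<open>Suc i\<close> goes to \<open>?n - 1\<close>, and \<open>?n - 1\<close> to
    \<open>Suc i\<close>.\<close>
  have high: "ys ! j = xs ! (?n + i - j)" if "i < j" "j < ?n" for j
  proof -
    have "Suc i + (?n - Suc i - Suc (j - Suc i)) = ?n + i - j" using that i by linarith
    then show ?thesis using that i by (simp add: ys_def nth_append rev_nth)
  qed
  have "{ys ! j, ys ! (Suc j mod ?n)} \<in> edges G" if j: "j < ?n" for j
  proof -
    consider "j < i" | "j = i" | "i < j" "Suc j < ?n" | "Suc j = ?n" using j by linarith
    then show ?thesis
    proof cases
      case 1
      then show ?thesis using path i low[of j] low[of "Suc j"] by simp
    next
      case 2
      then show ?thesis using cross(2) i low[of j] high[of "Suc j"] by simp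
    next
      case 3
      then have "{xs ! (?n + i - Suc j), xs ! Suc (?n + i - Suc j)} \<in> edges G"
        by (intro path) linarith
      moreover have "Suc (?n + i - Suc j) = ?n + i - j" using 3 by linarith
      ultimately show ?thesis
        using 3 high[of j] high[of "Suc j"] by (simp add: insert_commute)
    next
      case 4
      then have "?n + i - j = Suc i" by linarith
      then show ?thesis using 4 i cross(1) low[of 0] high[of j] by (simp add: insert_commute)
    qed
  qed
  then have "hamiltonian_cycle G ys"
    using dist set len xs by (auto simp: hamiltonian_cycle_def)
  then show ?thesis by (auto simp: hamiltonian_def)
qed

lemma hamiltonian_path_ore:
  assumes G: "simple_graph G"
    and xs: "distinct xs" "set xs = verts G" "3 \<le> length xs"
    and path: "\<And>j. Suc j < length xs \<Longrightarrow> {xs ! j, xs ! Suc j} \<in> edges G"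
    and deg: "length xs \<le> degree G (xs ! 0) + degree G (xs ! (length xs - 1))"
  shows "hamiltonian G"
proof -
  let ?n = "length xs"
  \<comment> \<open>\<open>A\<close> holds the path predecessors of neighbours of the first vertex,
    \<open>B\<close> the neighbours of the last vertex. A common index gives a crossing pair of
    chords.\<close>
  define A where "A = {i. Suc i < ?n \<and> {xs ! 0, xs ! Suc i} \<in> edges G}"
  define B where "B = {i. Suc i < ?n \<and> {xs ! i, xs ! (?n - 1)} \<in> edges G}"
  have fin: "finite A" "finite B"
    by (auto simp: A_def B_def intro: finite_subset[of _ "{..<?n}"])
  have "{w. {xs ! 0, w} \<in> edges G} \<subseteq> (\<lambda>i. xs ! Suc i) ` A"
  proof
    fix w assume w: "w \<in> {w. {xs ! 0, w} \<in> edges G}"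
    then have "w \<in> set xs" "w \<noteq> xs ! 0"
      using simple_graph_edgeD[OF G] xs(2) by auto
    then obtain k where "k < ?n" "w = xs ! k" "k \<noteq> 0" by (metis in_set_conv_nth)
    then show "w \<in> (\<lambda>i. xs ! Suc i) ` A"
      using w by (intro image_eqI[of _ _ "k - 1"]) (auto simp: A_def)
  qed
  then have degA: "degree G (xs ! 0) \<le> card A"
    unfolding degree_eq_card_neighbours[OF G] by (rule surj_card_le[OF fin(1)])
  have "{w. {xs ! (?n - 1), w} \<in> edges G} \<subseteq> (\<lambda>i. xs ! i) ` B"
  proof
    fix w assume w: "w \<in> {w. {xs ! (?n - 1), w} \<in> edges G}"
    then have "w \<in> set xs" "w \<noteq> xs ! (?n - 1)"
      using simple_graph_edgeD[OF G] xs(2) by auto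
    then obtain k where k: "k < ?n" "w = xs ! k" "k \<noteq> ?n - 1" by (metis in_set_conv_nth)
    then have "Suc k < ?n" by linarith
    then show "w \<in> (\<lambda>i. xs ! i) ` B"
      using w k by (auto simp: B_def insert_commute)
  qed
  then have degB: "degree G (xs ! (?n - 1)) \<le> card B"
    unfolding degree_eq_card_neighbours[OF G] by (rule surj_card_le[OF fin(2)])
  \<comment> \<open>Pigeonhole: only \<open>?n - 1\<close> positions have a successor, while the two
    cardinalities add up to at least \<open>?n\<close>.\<close>
  have "A \<union> B \<subseteq> {..<?n - 1}" by (auto simp: A_def B_def)
  then have "card (A \<union> B) \<le> ?n - 1" by (metis card_lessThan card_mono finite_lessThan)
  moreover have "card A + card B = card (A \<union> B) + card (A \<inter> B)"
    by (rule card_Un_Int[OF fin])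
  ultimately have "card (A \<inter> B) \<noteq> 0" using degA degB deg xs(3) by linarith
  then have "A \<inter> B \<noteq> {}" by (metis card.empty)
  then obtain i where "i \<in> A \<inter> B" by blast
  then show ?thesis using hamiltonian_path_crossing[OF xs path] by (auto simp: A_def B_def)
qed

text \<open>If \<open>G\<close> is not Hamiltonian, the cycle must use the new edge; deleting that
  edge leaves a Hamiltonian path of \<open>G\<close> between \<open>u\<close> and \<open>v\<close>,
  to which Ore's argument applies.\<close>

lemma hamiltonian_insert_edge:
  assumes G: "simple_graph G" and ham: "hamiltonian (G\<lparr>edges := insert {u, v} (edges G)\<rparr>)"
    and deg: "card (verts G) \<le> degree G u + degree G v"
  shows "hamiltonian G"
proof (rule ccontr)
  assume non: "\<not> hamiltonian G"
  let ?H = "G\<lparr>edges := insert {u, v} (edges G)\<rparr>"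
  obtain xs where xs: "hamiltonian_cycle ?H xs" using ham by (auto simp: hamiltonian_def)
  let ?n = "length xs"
  have "\<not> hamiltonian_cycle G xs" using non by (auto simp: hamiltonian_def)
  then obtain i where i: "i < ?n" "{xs ! i, xs ! (Suc i mod ?n)} = {u, v}"
    using xs by (auto simp: hamiltonian_cycle_def)
  \<comment> \<open>Rotating by \<open>Suc i\<close> makes the new edge the one from the last entry
    to the first.\<close>
  define ys where "ys = rotate (Suc i) xs"
  have ys: "distinct ys" "set ys = verts G" "3 \<le> length ys" and len: "length ys = ?n"
    and E: "\<And>j. j < ?n \<Longrightarrow> {ys ! j, ys ! (Suc j mod ?n)} \<in> insert {u, v} (edges G)"
    using hamiltonian_cycle_rotate[OF xs, of "Suc i"] by (auto simp: hamiltonian_cycle_def ys_def)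
  have "Suc i + (?n - 1) = i + ?n" "0 < ?n" using i(1) by linarith+
  then have "(Suc i + (?n - 1)) mod ?n = i" using i(1) by simp
  then have ends: "{ys ! (?n - 1), ys ! 0} = {u, v}"
    using i \<open>0 < ?n\<close> by (simp add: ys_def nth_rotate del: rotate_Suc)
  have inj: "ys ! a = ys ! b \<longleftrightarrow> a = b" if "a < ?n" "b < ?n" for a b
    using nth_eq_iff_index_eq[OF ys(1)] that len by simp
  have "{ys ! j, ys ! Suc j} \<in> edges G" if j: "Suc j < length ys" for j
  proof -
    have "{ys ! j, ys ! Suc j} \<noteq> {ys ! (?n - 1), ys ! 0}"
    proof
      assume "{ys ! j, ys ! Suc j} = {ys ! (?n - 1), ys ! 0}"
      \<comment> \<open>The first case contradicts \<open>Suc j < length ys\<close>; the second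
        would force a cycle of length 2.\<close>
      then have "j = ?n - 1 \<or> j = 0 \<and> Suc j = ?n - 1"
        using j len \<open>0 < ?n\<close> inj[of j 0] inj[of j "?n - 1"] inj[of "Suc j" "?n - 1"]
        by (auto simp: doubleton_eq_iff)
      then show False using j ys(3) len by auto
    qed
    then show ?thesis using E[of j] j ends len by auto
  qed
  moreover have "length ys \<le> degree G (ys ! 0) + degree G (ys ! (length ys - 1))"
    using deg ends len distinct_card[OF ys(1)] ys(2) by (auto simp: doubleton_eq_iff)
  ultimately show False using hamiltonian_path_ore[OF G ys] non by blast
qed

section \<open>Edge-maximal non-Hamiltonian graphs\<close>

lemma non_hamiltonian_maximal_extension:
  assumes G: "simple_graph G" and non: "\<not> hamiltonian G"
  obtains H where "verts H = verts G" "simple_graph H" "edges G \<subseteq> edges H" "\<not> hamiltonian H"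
    and "\<And>u v. u \<in> verts G \<Longrightarrow> v \<in> verts G \<Longrightarrow> u \<noteq> v \<Longrightarrow> {u, v} \<notin> edges H \<Longrightarrow>
      hamiltonian (H\<lparr>edges := insert {u, v} (edges H)\<rparr>)"
proof -
  let ?P = "{e. e \<subseteq> verts G \<and> card e = 2}"
  define X where "X = {E. edges G \<subseteq> E \<and> E \<subseteq> ?P \<and> \<not> hamiltonian (G\<lparr>edges := E\<rparr>)}"
  have "finite (verts G)" using G by (simp add: simple_graph_def)
  then have "finite X"
    using finite_subset[of X "Pow (Pow (verts G))"] by (auto simp: X_def)
  moreover have "edges G \<in> X" using G non by (simp add: simple_graph_def X_def)
  ultimately have "\<exists>M\<in>X. edges G \<subseteq> M \<and> (\<forall>E\<in>X. M \<subseteq> E \<longrightarrow> M = E)"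
    by (rule finite_has_maximal2)
  then obtain M where MX: "M \<in> X" and max: "\<And>E. E \<in> X \<Longrightarrow> M \<subseteq> E \<Longrightarrow> M = E"
    by metis
  from MX have M: "edges G \<subseteq> M" "M \<subseteq> ?P" "\<not> hamiltonian (G\<lparr>edges := M\<rparr>)" by (auto simp: X_def)
  show thesis
  proof (rule that[of "G\<lparr>edges := M\<rparr>"])
    fix u v
    assume "u \<in> verts G" "v \<in> verts G" "u \<noteq> v" and new: "{u, v} \<notin> edges (G\<lparr>edges := M\<rparr>)"
    then have "insert {u, v} M \<subseteq> ?P" using M by auto
    moreover have "insert {u, v} M \<notin> X" using max[of "insert {u, v} M"] new by auto
    ultimately show "hamiltonian (G\<lparr>edges := M, edges := insert {u, v} (edges (G\<lparr>edges := M\<rparr>))\<rparr>)"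
      using M by (auto simp: X_def)
  qed (use M G in \<open>auto simp: simple_graph_def\<close>)
qed

text \<open>The set \<open>S\<close> feeds the edge count. The vertex \<open>u\<close> bounds
  \<open>i\<close> from below by the minimum degree, even in the case \<open>i = 0\<close>, where
  \<open>S\<close> is empty.\<close>

lemma non_hamiltonian_small_degrees:
  assumes G: "simple_graph G" and n: "3 \<le> card (verts G)" and non: "\<not> hamiltonian G"
  obtains i u S where "2 * i < card (verts G)" "u \<in> verts G" "degree G u \<le> i"
    "S \<subseteq> verts G" "card S = i" "\<And>x. x \<in> S \<Longrightarrow> degree G x \<le> i"
proof -
  obtain H where H: "verts H = verts G" "simple_graph H" "edges G \<subseteq> edges H" "\<not> hamiltonian H"
    and max: "\<And>u v. u \<in> verts G \<Longrightarrow> v \<in> verts G \<Longrightarrow> u \<noteq> v \<Longrightarrow> {u, v} \<notin> edges H \<Longrightarrow>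
      hamiltonian (H\<lparr>edges := insert {u, v} (edges H)\<rparr>)"
    using non_hamiltonian_maximal_extension[OF G non] by metis
  let ?V = "verts G" and ?d = "degree H"
  have fin: "finite ?V" using G by (simp add: simple_graph_def)
  let ?N = "{(u, v). u \<in> ?V \<and> v \<in> ?V \<and> u \<noteq> v \<and> {u, v} \<notin> edges H}"
  have finN: "finite ?N" by (rule finite_subset[of _ "?V \<times> ?V"]) (use fin in auto)
  have neN: "?N \<noteq> {}"
    using hamiltonian_complete[of H] H n fin by auto
  let ?s = "\<lambda>(u, v). ?d u + ?d v"
  have "Max (?s ` ?N) \<in> ?s ` ?N" using finN neN by (intro Max_in) auto
  then obtain u0 v0 where uv0: "(u0, v0) \<in> ?N" "Max (?s ` ?N) = ?d u0 + ?d v0" by auto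
  have max0: "?d x + ?d y \<le> ?d u0 + ?d v0" if "(x, y) \<in> ?N" for x y
  proof -
    have "?s (x, y) \<le> Max (?s ` ?N)" using finN that by (intro Max_ge) auto
    then show ?thesis using uv0 by simp
  qed
  obtain u v where uv: "(u, v) \<in> ?N" "?d u \<le> ?d v" "?d u + ?d v = ?d u0 + ?d v0"
  proof (cases "?d u0 \<le> ?d v0")
    case True
    then show ?thesis using uv0 that[of u0 v0] by simp
  next
    case False
    then show ?thesis using uv0 that[of v0 u0] by (auto simp: insert_commute)
  qed
  \<comment> \<open>Otherwise Ore's condition would carry Hamiltonicity from \<open>H\<close> with
    the edge \<open>{u, v}\<close> added back to \<open>H\<close>.\<close>
  have sum: "?d u + ?d v < card ?V"
    using hamiltonian_insert_edge[OF H(2), of u v] max[of u v] uv(1) H by fastforce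
  let ?W = "{w. {v, w} \<in> edges H}"
  let ?S = "?V - insert v ?W"
  have W: "?W \<subseteq> ?V" "v \<notin> ?W"
    using simple_graph_edgeD[OF H(2)] simple_graph_edgeD(1)[OF H(2), of v v] H(1) by auto
  then have "finite ?W" using fin finite_subset by blast
  then have "card (insert v ?W) = Suc (?d v)"
    using W by (simp add: degree_eq_card_neighbours[OF H(2)])
  moreover have "card ?S = card ?V - card (insert v ?W)"
    using W uv(1) \<open>finite ?W\<close> by (intro card_Diff_subset) auto
  ultimately have "?d u \<le> card ?S" using sum by linarith
  then obtain S where S: "S \<subseteq> ?S" "card S = ?d u" by (meson obtain_subset_with_card_n)
  have mono: "degree G x \<le> ?d x" for x
    by (rule degree_mono[OF simple_graph_finite_edges[OF H(2)] H(3)])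
  show thesis
  proof (rule that[of "?d u" u S])
    fix x assume "x \<in> S"
    then have "(x, v) \<in> ?N" using S(1) uv(1) by (auto simp: insert_commute)
    \<comment> \<open>Replacing \<open>u\<close> by \<open>x\<close> in the nonadjacent pair cannot
      increase the maximal degree sum.\<close>
    then have "?d x \<le> ?d u" using max0[of x v] uv(3) by linarith
    then show "degree G x \<le> ?d u" using mono[of x] by linarith
  qed (use S uv sum mono in auto)
qed

subsection \<open>The extremal graph\<close>

text \<open>An empty edge has the same image under \<open>Inl\<close> and \<open>Inr\<close>;
  excluding it from \<open>G\<close> keeps the two image families disjoint.\<close>

lemma num_edges_disjoint_union:
  assumes "finite (edges G)" "finite (edges H)" "{} \<notin> edges G"
  shows "num_edges (disjoint_union G H) = num_edges G + num_edges H"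
proof -
  have "(\<lambda>e. Inl ` e) ` edges G \<inter> (\<lambda>e. Inr ` e) ` edges H = ({} :: ('a + 'b) set set)"
  proof (intro equals0I, elim IntE imageE)
    fix x a b
    assume x: "x = Inl ` a" "x = (Inr ` b :: ('a + 'b) set)" "a \<in> edges G"
    then obtain y where "y \<in> a" using assms(3) by (metis equals0I)
    then show False using x by blast
  qed
  moreover have "inj_on (\<lambda>e. Inl ` e :: ('a + 'b) set) (edges G)"
    "inj_on (\<lambda>e. Inr ` e :: ('a + 'b) set) (edges H)"
    by (auto intro!: inj_onI simp: inj_image_eq_iff)
  ultimately show ?thesis
    using assms by (simp add: num_edges_def disjoint_union_def card_Un_disjoint card_image)
qed

lemma num_edges_join:
  assumes "finite (verts G)" "finite (verts H)" "finite (edges G)" "finite (edges H)"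
    "{} \<notin> edges G"
  shows "num_edges (join G H) = num_edges G + num_edges H + card (verts G) * card (verts H)"
proof -
  let ?C = "{{Inl u, Inr v} | u v. u \<in> verts G \<and> v \<in> verts H} :: ('a + 'b) set set"
  have C: "?C = (\<lambda>(u, v). {Inl u, Inr v}) ` (verts G \<times> verts H)" by auto
  have "inj_on (\<lambda>(u, v). {Inl u, Inr v} :: ('a + 'b) set) (verts G \<times> verts H)"
    by (auto simp: inj_on_def doubleton_eq_iff)
  then have "card ?C = card (verts G) * card (verts H)"
    unfolding C by (simp add: card_image card_cartesian_product)
  moreover have "edges (disjoint_union G H) \<inter> ?C = {}"
    by (auto simp: disjoint_union_def)
  moreover have "finite ?C" unfolding C using assms by simp
  moreover have "finite (edges (disjoint_union G H))"
    using assms by (simp add: disjoint_union_def)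
  ultimately show ?thesis
    using num_edges_disjoint_union[OF assms(3-5)]
    by (simp add: num_edges_def join_def card_Un_disjoint)
qed

lemma num_edges_extremal_graph:
  "num_edges (extremal_graph n \<delta>) =
    (\<delta> choose 2) + (n - 2 * \<delta> + 1 choose 2) + \<delta> * (n - 2 * \<delta> + 1 + (\<delta> - 1))"
proof -
  have K: "finite (edges (complete_graph m))" "{} \<notin> edges (complete_graph m)"
    "num_edges (complete_graph m) = m choose 2" "verts (complete_graph m) = {..<m}" for m
    using n_subsets[of "{..<m}" 2] by (auto simp: complete_graph_def num_edges_def)
  let ?D = "disjoint_union (complete_graph (n - 2 * \<delta> + 1)) (isolated_vertices (\<delta> - 1))"
  have "verts ?D = {..<n - 2 * \<delta> + 1} <+> {..<\<delta> - 1}" "finite (edges ?D)"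
    using K by (simp_all add: disjoint_union_def isolated_vertices_def)
  moreover have "num_edges ?D = (n - 2 * \<delta> + 1) choose 2"
    using K by (subst num_edges_disjoint_union) (auto simp: isolated_vertices_def num_edges_def)
  ultimately show ?thesis
    unfolding extremal_graph_def
    using K by (subst num_edges_join) (auto simp: card_Plus)
qed

text \<open>Over the reals \<open>m - 1\<close> is not truncated, so the polynomial formula also
  covers \<open>m = 0\<close>.\<close>

lemma real_choose_two: "real (m choose 2) = real m * (real m - 1) / 2"
  by (cases m) (simp_all add: choose_two real_of_nat_div algebra_simps)

lemma erdos_bound_less_extremal:
  assumes "2 \<le> \<delta>" "\<delta> \<le> i" "2 * i < n" "even n" "6 * \<delta> \<le> n + 4"
  shows "i * i + (n - i choose 2) < num_edges (extremal_graph n \<delta>)"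
proof -
  let ?n = "real n" and ?d = "real \<delta>" and ?i = "real i"
  \<comment> \<open>Parity enters here: with \<open>n = 2 * m\<close>, the bounds
    \<open>i \<le> m - 1\<close> and \<open>3 * \<delta> \<le> m + 2\<close> add up to
    \<open>3 * i + 3 * \<delta> \<le> 4 * m - 1\<close>.\<close>
  have "3 * i + 3 * \<delta> + 1 \<le> 2 * n"
  proof -
    obtain m where m: "n = 2 * m" using assms(4) by (elim evenE)
    then have "i + 1 \<le> m" "3 * \<delta> \<le> m + 2" using assms(3,5) by auto
    then show ?thesis using m by linarith
  qed
  then have "3 * ?i + 3 * ?d + 1 \<le> 2 * ?n" by linarith
  then have "0 \<le> (?i - ?d) * (2 * ?n - 1 - 3 * ?i - 3 * ?d)"
    using assms(2) by (intro mult_nonneg_nonneg) auto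
  moreover have "2 * ?d < ?n" using assms(2,3) by linarith
  then have "0 < 2 * (?n - 2 * ?d)" by simp
  ultimately have "0 < (?i - ?d) * (2 * ?n - 1 - 3 * ?i - 3 * ?d) + 2 * (?n - 2 * ?d)"
    by (rule add_nonneg_pos)
  \<comment> \<open>The natural subtractions are exact since
    \<open>2 * \<delta> \<le> 2 * i < n\<close> and \<open>\<delta> \<ge> 2\<close>.\<close>
  also have "\<dots> = 2 * (real (num_edges (extremal_graph n \<delta>)) - real (i * i + (n - i choose 2)))"
    using assms(1-3)
    by (simp add: num_edges_extremal_graph real_choose_two of_nat_diff field_simps)
  finally have "real (i * i + (n - i choose 2)) < real (num_edges (extremal_graph n \<delta>))"
    by simp
  then show ?thesis by linarith
qed

theorem theorem1p1:
  fixes G :: "'a graph" and n \<delta> :: nat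
  assumes "\<delta> \<ge> 2"
    and "simple_graph G"
    and "connected_graph G"
    and "graph_order G = n"
    and "even n"
    and "real n \<ge> max (6 * real \<delta> - 4) (1 / 6 * ((real \<delta>)\<^sup>2 + 7 * real \<delta> + 4))"
    and "min_degree G = \<delta>"
    and "num_edges G \<ge> num_edges (extremal_graph n \<delta>)"
  shows "(\<exists>F. even_factor F G) \<or> isomorphic G (extremal_graph n \<delta>)"
proof -
  have "6 * real \<delta> \<le> real n + 4" using assms(6) by simp
  then have n: "6 * \<delta> \<le> n + 4" by linarith
  have card: "card (verts G) = n" using assms(4) by (simp add: graph_order_def)
  have "hamiltonian G"
  proof (rule ccontr)
    assume "\<not> hamiltonian G"
    \<comment> \<open>From \<open>\<delta> \<ge> 2\<close> and
      \<open>6 * \<delta> \<le> n + 4\<close> follows \<open>n \<ge> 8\<close>, so there are at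
      least three vertices.\<close>
    then obtain i u S where i: "2 * i < n" "u \<in> verts G" "degree G u \<le> i"
      and S: "S \<subseteq> verts G" "card S = i" "\<And>x. x \<in> S \<Longrightarrow> degree G x \<le> i"
      using non_hamiltonian_small_degrees[OF assms(2)] card n assms(1) by auto
    \<comment> \<open>Together with \<open>degree G u \<le> i\<close> this puts \<open>i\<close> in
      the range where the edge bound stays below the extremal count.\<close>
    have "\<delta> \<le> degree G u"
      using i(2) assms(2,7) by (auto simp: min_degree_def simple_graph_def)
    then have "i * i + (n - i choose 2) < num_edges (extremal_graph n \<delta>)"
      using i assms n by (intro erdos_bound_less_extremal) auto
    then show False
      using num_edges_le_small_degrees[OF assms(2) S(1,3)] S(2) card assms(8) by simp
  qed
  then show ?thesis using even_factor_of_hamiltonian by blast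
qed

end
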